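(* If the function $c:\mathbb{X}\times\mathbb{A}\to\overline{\mathbb{R}}$ is bounded below and $\mathbb{K}$-inf-compact on $\mathbb{X}\times\mathbb{A}$, then the function $\bar c:\mathbb{P}(\mathbb{X})\times\mathbb{A}\to\overline{\mathbb{R}}$ defined by $\bar c(z,a)=\int_{\mathbb{X}}c(x,a)\,z(dx)$ is bounded from below by the same constant as $c$ and is $\mathbb{K}$-inf-compact on $\mathbb{P}(\mathbb{X})\times\mathbb{A}$.
   Context: $\mathbb{X}$ and $\mathbb{A}$ are nonempty Borel subsets of Polish spaces; $\overline{\mathbb{R}}=\mathbb{R}\cup\{+\infty\}$. $\mathbb{P}(\mathbb{X})$ is the set of Borel probability measures on $\mathbb{X}$ endowed with the topology of weak convergence (a separable metrizable space). For metric spaces $\mathbb{S}_1,\mathbb{S}_2$, a function $f:\mathbb{S}_1\times\mathbb{S}_2\to\overline{\mathbb{R}}$ is inf-compact if $\{f\le\lambda\}$ is compact for every $\lambda\in\mathbb{R}$; it is $\mathbb{K}$-inf-compact on $\mathbb{S}_1\times\mathbb{S}_2$ if for every compact $K\subseteq\mathbb{S}_1$ the restriction of $f$ to $K\times\mathbb{S}_2$ is inf-compact. *)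

theory Defs
  imports "HOL-Probability.Probability"
begin

definition inf_compact :: "'a topology \<Rightarrow> ('a \<Rightarrow> ereal) \<Rightarrow> bool" where
  "inf_compact S f \<longleftrightarrow>
     (\<forall>r::real. compactin S {s \<in> topspace S. f s \<le> ereal r})"

definition K_inf_compact ::
    "'a topology \<Rightarrow> 'b topology \<Rightarrow> ('a \<times> 'b \<Rightarrow> ereal) \<Rightarrow> bool" where
  "K_inf_compact S1 S2 f \<longleftrightarrow>
     (\<forall>K. compactin S1 K \<longrightarrow> inf_compact (prod_topology (subtopology S1 K) S2) f)"

text \<open>
  Borel probability measures on a subset \<open>X\<close>: their \<open>\<sigma>\<close>-algebra is the Borel
  \<open>\<sigma>\<close>-algebra of the subspace \<open>X\<close>, and their underlying space is \<open>X\<close> itself.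
\<close>

definition prob_measures_on :: "'a::topological_space set \<Rightarrow> 'a measure set" where
  "prob_measures_on X = space (prob_algebra (restrict_space borel X))"

text \<open>
  The coarsest topology on the probability measures on \<open>X\<close> for which integration of every
  bounded function that is continuous on the subspace \<open>X\<close> is continuous.
\<close>

definition weak_topology :: "'a::topological_space set \<Rightarrow> 'a measure topology" where
  "weak_topology X = topology_generated_by
     {{z \<in> prob_measures_on X. (\<integral>x. f x \<partial>z) \<in> U} |(f :: 'a \<Rightarrow> real) U.
        continuous_on X f \<and> bounded (f ` X) \<and> open U}"

lemma topspace_weak_topology [simp]: "topspace (weak_topology X) = prob_measures_on X"
proof -
  have "prob_measures_on X \<in> {{z \<in> prob_measures_on X. (\<integral>x. f x \<partial>z) \<in> U} |(f :: 'a \<Rightarrow> real) U.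
        continuous_on X f \<and> bounded (f ` X) \<and> open U}"
    by (rule CollectI, rule exI[of _ "\<lambda>_. 0"], rule exI[of _ UNIV]) (auto simp: bounded_iff)
  then show ?thesis
    unfolding weak_topology_def topology_generated_by_topspace by blast
qed

text \<open>
  The integral of an extended-real function, as the difference of the integrals of its positive
  and negative parts; \<^const>\<open>e2ennreal\<close> sends negative values to \<open>0\<close>. For a function bounded
  below on a probability space the subtrahend is finite, so no \<open>\<infinity> - \<infinity>\<close> arises.
\<close>

definition ereal_integral :: "'a measure \<Rightarrow> ('a \<Rightarrow> ereal) \<Rightarrow> ereal" where
  "ereal_integral M f =
     enn2ereal (\<integral>\<^sup>+x. e2ennreal (f x) \<partial>M) - enn2ereal (\<integral>\<^sup>+x. e2ennreal (- f x) \<partial>M)"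

definition averaged_cost :: "('a \<times> 'b \<Rightarrow> ereal) \<Rightarrow> 'a measure \<times> 'b \<Rightarrow> ereal" where
  "averaged_cost c = (\<lambda>(z, a). ereal_integral z (\<lambda>x. c (x, a)))"

end

theory Submission
  imports Defs
begin

text \<open>
  The key is Fatou's lemma for weakly convergent measures, in the form that
  \<open>\<integral> liminf F\<^sub>N(y) z(dx) > u\<close> (limit over \<open>N \<rightarrow> \<infinity>\<close>, \<open>y \<rightarrow> x\<close>, with \<open>F\<^sub>N\<close> increasing) forces
  \<open>\<integral> F\<^sub>N dz' > u\<close> for one \<open>N\<close> and all \<open>z'\<close> in a weak neighbourhood of \<open>z\<close>; the \<open>F\<^sub>N\<close> are
  approximated from below by bounded Lipschitz inf-convolutions, whose integrals are weakly
  continuous. Applied to infima of \<open>c - L\<close> over shrinking balls in the action, it makes the averaged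
  cost lower semicontinuous. Applied to \<open>F\<^sub>N(x) = inf {c(x, a\<^sub>n) - L | n \<ge> N}\<close> it shows that actions
  \<open>a\<^sub>n\<close> with bounded averaged costs against \<open>z\<^sub>n\<close> in a weakly compact set subconverge: otherwise
  K-inf-compactness gives \<open>F\<^sub>N(y) \<rightarrow> \<infinity>\<close> as \<open>y \<rightarrow> x\<close>, for every \<open>x\<close>. Neither tightness nor metrizability
  of the weak topology is needed.
\<close>

section \<open>Bounded Lipschitz minorants by inf-convolution\<close>

text \<open>The Pasch-Hausdorff envelope of \<open>F\<close> truncated at \<open>N\<close>.
  Truncation makes it real and bounded, the penalty makes it \<open>N\<close>-Lipschitz, so it is a
  test function for the weak topology; one index drives both to the limit.\<close>

definition inf_conv :: "'a::metric_space set \<Rightarrow> ('a \<Rightarrow> ennreal) \<Rightarrow> nat \<Rightarrow> 'a \<Rightarrow> real" where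
  "inf_conv X F N x = (INF y\<in>X. enn2real (min (of_nat N) (F y)) + real N * dist x y)"

lemma bdd_below_inf_conv:
  "bdd_below ((\<lambda>y. enn2real (min (of_nat N) (F y)) + real N * dist x y) ` X)"
  by (rule bdd_belowI2[of _ 0]) simp

lemma inf_conv_lower:
  assumes "y \<in> X"
  shows "inf_conv X F N x \<le> enn2real (min (of_nat N) (F y)) + real N * dist x y"
  unfolding inf_conv_def by (rule cINF_lower[OF bdd_below_inf_conv assms])

lemma inf_conv_nonneg: "X \<noteq> {} \<Longrightarrow> 0 \<le> inf_conv X F N x"
  unfolding inf_conv_def by (rule cINF_greatest) auto

lemma enn2real_min_le: "enn2real (min (of_nat N) u) \<le> real N"
  using enn2real_mono[of "min (of_nat N) u" "of_nat N :: ennreal"]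
  by (simp add: ennreal_of_nat_eq_real_of_nat)

lemma ennreal_enn2real_min: "ennreal (enn2real (min (of_nat N) u)) = min (of_nat N) u"
  by (rule ennreal_enn2real)
    (simp add: ennreal_of_nat_eq_real_of_nat min_less_iff_disj)

lemma inf_conv_le_nat: "x \<in> X \<Longrightarrow> inf_conv X F N x \<le> real N"
  using inf_conv_lower[of x X F N x] enn2real_min_le[of N "F x"] by simp

lemma inf_conv_le: "x \<in> X \<Longrightarrow> ennreal (inf_conv X F N x) \<le> F x"
  using inf_conv_lower[of x X F N x] ennreal_enn2real_min[of N "F x"]
  by (metis add.right_neutral dist_self ennreal_leI min.boundedE mult_zero_right)

text \<open>By the triangle inequality each function under the infimum is \<open>N\<close>-Lipschitz
  in \<open>x\<close>, and this passes to the infimum.\<close>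

lemma inf_conv_lipschitz:
  assumes "X \<noteq> {}"
  shows "inf_conv X F N x \<le> inf_conv X F N y + real N * dist x y"
proof -
  have "inf_conv X F N x - real N * dist x y \<le> inf_conv X F N y"
    unfolding inf_conv_def[of _ _ _ y]
  proof (rule cINF_greatest[OF assms])
    fix u assume u: "u \<in> X"
    have "real N * dist x u \<le> real N * (dist x y + dist y u)"
      by (intro mult_left_mono dist_triangle) simp
    then show "inf_conv X F N x - real N * dist x y
        \<le> enn2real (min (of_nat N) (F u)) + real N * dist y u"
      using inf_conv_lower[OF u, of F N x] by (simp add: algebra_simps)
  qed
  then show ?thesis by simp
qed

lemma continuous_on_inf_conv:
  assumes "X \<noteq> {}"
  shows "continuous_on S (inf_conv X F N)"
proof (rule lipschitz_on_continuous_on)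
  show "(real N)-lipschitz_on S (inf_conv X F N)"
  proof (rule lipschitz_onI)
    fix x y show "dist (inf_conv X F N x) (inf_conv X F N y) \<le> real N * dist x y"
      using inf_conv_lipschitz[OF assms, of F N x y] inf_conv_lipschitz[OF assms, of F N y x]
      by (simp add: dist_real_def dist_commute abs_le_iff)
  qed simp
qed

lemma inf_conv_mono:
  assumes "X \<noteq> {}" and "M \<le> N" and "\<And>y. y \<in> X \<Longrightarrow> F y \<le> G y"
  shows "inf_conv X F M x \<le> inf_conv X G N x"
  unfolding inf_conv_def
proof (rule cINF_mono[OF assms(1) bdd_below_inf_conv])
  fix y assume y: "y \<in> X"
  have "enn2real (min (of_nat M) (F y)) \<le> enn2real (min (of_nat N) (G y))"
    using assms(2) assms(3)[OF y]
    by (intro enn2real_mono min.mono)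
      (auto simp: ennreal_of_nat_eq_real_of_nat min_less_iff_disj ennreal_leI)
  moreover have "real M * dist x y \<le> real N * dist x y"
    using assms(2) by (intro mult_right_mono) auto
  ultimately show "\<exists>y'\<in>X. enn2real (min (of_nat M) (F y')) + real M * dist x y'
      \<le> enn2real (min (of_nat N) (G y)) + real N * dist x y"
    using y by (intro bexI[of _ y]) auto
qed

text \<open>Points within \<open>e\<close> of \<open>x\<close> contribute at least \<open>M\<close>
  through the truncated \<open>F\<close>, all others through the distance penalty, which is at least
  \<open>N * e\<close>.\<close>

lemma inf_conv_ge:
  assumes "X \<noteq> {}" and "M \<le> real N" and "M \<le> real N * e"
    and F: "\<And>y. y \<in> X \<Longrightarrow> dist x y < e \<Longrightarrow> ennreal M \<le> F y"
  shows "M \<le> inf_conv X F N x"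
  unfolding inf_conv_def
proof (rule cINF_greatest[OF assms(1)])
  fix y assume y: "y \<in> X"
  show "M \<le> enn2real (min (of_nat N) (F y)) + real N * dist x y"
  proof (cases "dist x y < e")
    case True
    have "ennreal M \<le> min (of_nat N) (F y)"
      using F[OF y True] assms(2) by (simp add: ennreal_of_nat_eq_real_of_nat ennreal_leI)
    then have "M \<le> enn2real (min (of_nat N) (F y))"
      by (subst (asm) ennreal_enn2real_min[symmetric])
        (metis enn2real_nonneg ennreal_le_iff)
    then show ?thesis by (simp add: add_increasing2)
  next
    case False
    then have "real N * e \<le> real N * dist x y"
      by (intro mult_left_mono) auto
    with assms(3) show ?thesis
      by (smt (verit) enn2real_nonneg)
  qed
qed

section \<open>Fatou's lemma on weak neighbourhoods\<close>

lemma prob_measures_onD: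
  assumes "z \<in> prob_measures_on X"
  shows "sets z = sets (restrict_space borel X)" "space z = X" "prob_space z"
proof -
  show s: "sets z = sets (restrict_space borel X)" and "prob_space z"
    using assms by (auto simp: prob_measures_on_def space_prob_algebra)
  show "space z = X"
    using sets_eq_imp_space_eq[OF s] by (simp add: space_restrict_space)
qed

text \<open>Links the two integrals in play: the weak topology is generated by Bochner integrals,
  while costs are integrated in \<open>ennreal\<close>.\<close>

lemma nn_integral_inf_conv:
  assumes "X \<noteq> {}" and z: "z \<in> prob_measures_on X"
  shows "(\<integral>\<^sup>+x. ennreal (inf_conv X F N x) \<partial>z) = ennreal (\<integral>x. inf_conv X F N x \<partial>z)"
    and "inf_conv X F N \<in> borel_measurable z"
proof -
  interpret prob_space z by (rule prob_measures_onD[OF z])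
  have "inf_conv X F N \<in> borel_measurable (restrict_space borel X)"
    by (intro borel_measurable_continuous_on_restrict continuous_on_inf_conv assms)
  then show m: "inf_conv X F N \<in> borel_measurable z"
    by (simp cong: measurable_cong_sets add: measurable_cong_sets[OF prob_measures_onD(1)[OF z] refl])
  have "integrable z (inf_conv X F N)"
    using m inf_conv_nonneg[OF assms(1)] inf_conv_le_nat prob_measures_onD(2)[OF z]
    by (intro integrable_const_bound[of _ "real N"] AE_I2) auto
  then show "(\<integral>\<^sup>+x. ennreal (inf_conv X F N x) \<partial>z) = ennreal (\<integral>x. inf_conv X F N x \<partial>z)"
    by (intro nn_integral_eq_integral) (auto simp: inf_conv_nonneg assms(1))
qed

text \<open>The inf-convolutions \<open>?h N\<close> of \<open>F N\<close> increase and their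
  supremum dominates \<open>g\<close>, so monotone convergence yields one \<open>N\<close> with
  integral above \<open>u\<close>. That strict inequality is weakly open in the measure and passes
  from \<open>?h N\<close> up to \<open>F N\<close>. Only the continuous \<open>?h N\<close> are
  treated as measurable; \<open>F\<close> and \<open>g\<close> are compared with them by
  monotonicity of the integral, which holds for arbitrary functions such as infima over uncountably
  many actions.\<close>

lemma fatou_weak:
  fixes X :: "'a::metric_space set" and F :: "nat \<Rightarrow> 'a \<Rightarrow> ennreal"
  assumes "X \<noteq> {}" and z: "z \<in> prob_measures_on X"
    and F: "\<And>M N x. M \<le> N \<Longrightarrow> x \<in> X \<Longrightarrow> F M x \<le> F N x"
    and g: "\<And>x M. x \<in> X \<Longrightarrow> 0 \<le> M \<Longrightarrow> ennreal M < g x \<Longrightarrow>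
      \<exists>e>0. \<exists>N. \<forall>y\<in>X. dist x y < e \<longrightarrow> ennreal M \<le> F N y"
    and u: "u < (\<integral>\<^sup>+x. g x \<partial>z)"
  obtains N W where "openin (weak_topology X) W" "z \<in> W"
    "\<And>z'. z' \<in> W \<Longrightarrow> u < (\<integral>\<^sup>+x. F N x \<partial>z')"
proof -
  let ?h = "\<lambda>N. inf_conv X (F N) N"
  have g_le: "g x \<le> (SUP N. ennreal (?h N x))" if x: "x \<in> X" for x
  proof (rule le_SUP_iff[THEN iffD2], intro allI impI)
    fix v assume v: "v < g x"
    \<comment> \<open>An intermediate value is taken because \<open>inf_conv_ge\<close> only gives a
      non-strict bound; lying below \<open>g x\<close>, it is finite and hence a real
      \<open>M\<close>.\<close>
    obtain v' where v': "v < v'" "v' < g x" using dense[OF v] by blast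
    then obtain M where M: "v' = ennreal M" "0 \<le> M"
      by (cases v') auto
    obtain e N0 where e: "e > 0" "\<And>y. y \<in> X \<Longrightarrow> dist x y < e \<Longrightarrow> ennreal M \<le> F N0 y"
      using g[OF x M(2)] v' M(1) by blast
    \<comment> \<open>\<open>N0\<close> makes \<open>F\<close> large near \<open>x\<close>,
      \<open>N1\<close> meets the two size conditions of \<open>inf_conv_ge\<close>; monotonicity of
      \<open>F\<close> permits passing to their maximum.\<close>
    obtain N1 where N1: "max M (M / e) \<le> real N1" using real_arch_simple by blast
    define N where "N = max N0 N1"
    have "M / e \<le> real N" "M \<le> real N"
      using N1 unfolding N_def by linarith+
    then have "M \<le> ?h N x"
      using e F[of N0 N]
      by (intro inf_conv_ge[where e=e] assms(1))
        (auto simp: N_def field_simps intro: order_trans)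
    then show "\<exists>N\<in>UNIV. v < ennreal (?h N x)"
      using v' M by (metis UNIV_I ennreal_leI order_less_le_trans)
  qed
  have "incseq (\<lambda>N x. ennreal (?h N x))"
    by (intro incseq_SucI le_funI ennreal_leI inf_conv_mono assms(1) F) auto
  then have "(\<integral>\<^sup>+x. (SUP N. ennreal (?h N x)) \<partial>z) = (SUP N. \<integral>\<^sup>+x. ennreal (?h N x) \<partial>z)"
    by (intro nn_integral_monotone_convergence_SUP)
      (auto intro!: measurable_compose[OF nn_integral_inf_conv(2)[OF assms(1) z]])
  moreover have "(\<integral>\<^sup>+x. g x \<partial>z) \<le> (\<integral>\<^sup>+x. (SUP N. ennreal (?h N x)) \<partial>z)"
    by (intro nn_integral_mono g_le) (simp add: prob_measures_onD(2)[OF z])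
  ultimately have "u < (SUP N. \<integral>\<^sup>+x. ennreal (?h N x) \<partial>z)"
    using u by (simp add: order_less_le_trans)
  then obtain N where N: "u < (\<integral>\<^sup>+x. ennreal (?h N x) \<partial>z)"
    unfolding less_SUP_iff by blast
  then obtain r where r: "u = ennreal r" "0 \<le> r"
    by (cases u) auto
  \<comment> \<open>A subbasic open set: the preimage of a ray under integration of the test
    function \<open>?h N\<close>.\<close>
  define W where "W = {z' \<in> prob_measures_on X. (\<integral>x. ?h N x \<partial>z') \<in> {r<..}}"
  have int_iff: "r < (\<integral>x. ?h N x \<partial>z') \<longleftrightarrow> u < (\<integral>\<^sup>+x. ennreal (?h N x) \<partial>z')"
    if "z' \<in> prob_measures_on X" for z'
    using nn_integral_inf_conv(1)[OF assms(1) that, of "F N" N] r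
    by (simp add: ennreal_less_iff)
  have "continuous_on X (?h N) \<and> bounded (?h N ` X) \<and> open {r<..}"
    using inf_conv_le_nat[of _ X "F N" N] inf_conv_nonneg[OF assms(1), of "F N" N]
    by (auto simp: bounded_iff intro!: continuous_on_inf_conv assms(1) exI[of _ "real N"])
  then have "openin (weak_topology X) W"
    unfolding weak_topology_def W_def by (intro topology_generated_by_Basis) blast
  moreover have "z \<in> W"
    using z N int_iff[OF z] by (simp add: W_def)
  moreover have "u < (\<integral>\<^sup>+x. F N x \<partial>z')" if "z' \<in> W" for z'
  proof -
    have z': "z' \<in> prob_measures_on X" using that by (simp add: W_def)
    have "u < (\<integral>\<^sup>+x. ennreal (?h N x) \<partial>z')"
      using that int_iff[OF z'] by (simp add: W_def)
    also have "\<dots> \<le> (\<integral>\<^sup>+x. F N x \<partial>z')"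
      by (intro nn_integral_mono inf_conv_le) (simp add: prob_measures_onD(2)[OF z'])
    finally show ?thesis .
  qed
  ultimately show ?thesis using that by blast
qed

section \<open>Sequences in compact sets and K-inf-compactness\<close>

text \<open>Otherwise each point of \<open>K\<close> has a neighbourhood that the sequence
  eventually avoids, and finitely many of these cover \<open>K\<close>. A cluster point replaces a
  convergent subsequence, so no countability of the topology enters.\<close>

lemma compactin_sequence_cluster_point:
  assumes K: "compactin T K" and z: "\<And>n::nat. z n \<in> K"
  obtains z0 where "z0 \<in> K" "\<And>U N. openin T U \<Longrightarrow> z0 \<in> U \<Longrightarrow> \<exists>n\<ge>N. z n \<in> U"
proof (rule ccontr)
  assume "\<not> thesis"
  then have "\<forall>y\<in>K. \<exists>U N. openin T U \<and> y \<in> U \<and> (\<forall>n\<ge>N. z n \<notin> U)"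
    using that by metis
  then obtain U N where U: "\<And>y. y \<in> K \<Longrightarrow> openin T (U y) \<and> y \<in> U y \<and> (\<forall>n\<ge>N y. z n \<notin> U y)"
    by metis
  have "\<exists>\<F>. finite \<F> \<and> \<F> \<subseteq> U ` K \<and> K \<subseteq> \<Union>\<F>"
    using U by (intro compactinD[OF K]) auto
  then obtain S where S: "finite S" "S \<subseteq> K" "K \<subseteq> \<Union>(U ` S)"
    by (metis finite_subset_image)
  \<comment> \<open>An index beyond all thresholds of the finite subcover; the \<open>0\<close>
    keeps the set under \<open>Max\<close> nonempty.\<close>
  have "z (Max (insert 0 (N ` S))) \<in> \<Union>(U ` S)" using z S by blast
  then obtain y where y: "y \<in> S" "z (Max (insert 0 (N ` S))) \<in> U y" by blast
  moreover have "N y \<le> Max (insert 0 (N ` S))" using y S by simp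
  ultimately show False using U S(2) by blast
qed

lemma compact_insert_limit_range:
  fixes x :: "nat \<Rightarrow> 'a::topological_space"
  assumes "x \<longlonglongrightarrow> l"
  shows "compact (insert l (range x))"
proof (rule Topological_Spaces.compactI)
  fix \<C> assume C: "\<forall>U\<in>\<C>. open U" "insert l (range x) \<subseteq> \<Union>\<C>"
  then obtain U where U: "U \<in> \<C>" "l \<in> U" by blast
  then obtain N where N: "\<And>n. n \<ge> N \<Longrightarrow> x n \<in> U"
    using topological_tendstoD[OF assms] C(1) by (metis eventually_sequentially)
  obtain V where V: "\<And>n. V n \<in> \<C> \<and> x n \<in> V n" 
  proof -
    have "\<forall>n. \<exists>W. W \<in> \<C> \<and> x n \<in> W" using C(2) by blast
    then show ?thesis using that by metis
  qed
  have "insert l (range x) \<subseteq> \<Union>(insert U (V ` {..<N}))"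
  proof -
    have "x n \<in> \<Union>(insert U (V ` {..<N}))" for n
      using N[of n] V[of n] by (cases "n < N") auto
    then show ?thesis using U(2) by blast
  qed
  moreover have "insert U (V ` {..<N}) \<subseteq> \<C>" using U V by blast
  ultimately show "\<exists>\<D>\<subseteq>\<C>. finite \<D> \<and> insert l (range x) \<subseteq> \<Union>\<D>"
    by (intro exI[of _ "insert U (V ` {..<N})"]) auto
qed

text \<open>The sequence of states together with its limit is a compact \<open>K\<close>, so the
  sublevel set over \<open>K\<close> is compact and a subsequence of the pairs converges in it; the
  state component of the limit must be \<open>x0\<close>.\<close>

lemma K_inf_compact_sequence:
  fixes X :: "'a::metric_space set" and A :: "'b::metric_space set"
  assumes c: "K_inf_compact (top_of_set X) (top_of_set A) c"
    and x: "\<And>k::nat. x k \<in> X" "x \<longlonglongrightarrow> x0" "x0 \<in> X"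
    and a: "\<And>k. a k \<in> A" and le: "\<And>k. c (x k, a k) \<le> ereal M"
  obtains a0 s where "a0 \<in> A" "strict_mono (s :: nat \<Rightarrow> nat)" "(a \<circ> s) \<longlonglongrightarrow> a0"
    "c (x0, a0) \<le> ereal M"
proof -
  define K where "K = insert x0 (range x)"
  have K: "K \<subseteq> X" "compact K"
    using x compact_insert_limit_range[OF x(2)] by (auto simp: K_def)
  then have "compactin (top_of_set X) K" by (simp add: compactin_subtopology)
  then have "compactin (prod_topology (subtopology (top_of_set X) K) (top_of_set A))
      {s \<in> topspace (prod_topology (subtopology (top_of_set X) K) (top_of_set A)). c s \<le> ereal M}"
    using c unfolding K_inf_compact_def inf_compact_def by blast
  \<comment> \<open>Flattening to a subspace of the product type turns \<open>compactin\<close> into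
    \<open>compact\<close>, which is sequential compactness in metric spaces.\<close>
  moreover have "prod_topology (subtopology (top_of_set X) K) (top_of_set A) = top_of_set (K \<times> A)"
    using K(1) by (simp add: subtopology_subtopology Int_absorb1 flip: subtopology_Times)
  ultimately have cpt: "compact {s \<in> K \<times> A. c s \<le> ereal M}"
    by (simp add: compactin_subtopology)
  have "\<forall>k. (x k, a k) \<in> {s \<in> K \<times> A. c s \<le> ereal M}"
    using a le by (auto simp: K_def)
  then obtain l s where l: "l \<in> {s \<in> K \<times> A. c s \<le> ereal M}" "strict_mono (s :: nat \<Rightarrow> nat)"
      "((\<lambda>k. (x k, a k)) \<circ> s) \<longlonglongrightarrow> l"
    using cpt[unfolded compact_def, rule_format, of "\<lambda>k. (x k, a k)"] by blast
  have "(x \<circ> s) \<longlonglongrightarrow> fst l" "(a \<circ> s) \<longlonglongrightarrow> snd l"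
    using tendsto_fst[OF l(3)] tendsto_snd[OF l(3)] by (simp_all add: o_def)
  moreover have "(x \<circ> s) \<longlonglongrightarrow> x0" by (rule LIMSEQ_subseq_LIMSEQ[OF x(2) l(2)])
  ultimately have "fst l = x0" by (metis LIMSEQ_unique)
  with l \<open>(a \<circ> s) \<longlonglongrightarrow> snd l\<close> show ?thesis
    using that[of "snd l" s] by (auto simp: mem_Times_iff)
qed

lemma LIMSEQ_if_dist_inverse_Suc:
  assumes "\<And>k. dist x (y k) < inverse (real (Suc k))"
  shows "y \<longlonglongrightarrow> x"
proof (rule tendsto_dist_iff[THEN iffD2], rule tendsto_sandwich[OF _ _ tendsto_const LIMSEQ_inverse_real_of_nat])
  show "\<forall>\<^sub>F k in sequentially. dist (y k) x \<le> inverse (real (Suc k))"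
    using assms by (intro always_eventually allI) (metis dist_commute less_imp_le)
qed simp

text \<open>Joint lower semicontinuity: pairs converging to \<open>(x, a)\<close> with costs at most
  \<open>M\<close> would put \<open>(x, a)\<close> itself in the sublevel set, since the limiting
  action can only be \<open>a\<close>.\<close>

lemma K_inf_compact_lsc:
  fixes X :: "'a::metric_space set" and A :: "'b::metric_space set"
  assumes c: "K_inf_compact (top_of_set X) (top_of_set A) c"
    and "x \<in> X" "a \<in> A" "ereal M < c (x, a)"
  obtains e where "e > 0"
    "\<And>y b. y \<in> X \<Longrightarrow> b \<in> A \<Longrightarrow> dist x y < e \<Longrightarrow> dist a b < e \<Longrightarrow> ereal M < c (y, b)"
proof (rule ccontr)
  assume "\<not> thesis"
  then have "\<exists>y b. y \<in> X \<and> b \<in> A \<and> dist x y < inverse (real (Suc k)) \<and>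
      dist a b < inverse (real (Suc k)) \<and> c (y, b) \<le> ereal M" for k
    using that[of "inverse (real (Suc k))"] by (force simp: not_less)
  then obtain y b where yb: "\<And>k. y k \<in> X" "\<And>k. b k \<in> A"
      "\<And>k. dist x (y k) < inverse (real (Suc k))" "\<And>k. dist a (b k) < inverse (real (Suc k))"
      "\<And>k. c (y k, b k) \<le> ereal M"
    by metis
  have lim: "y \<longlonglongrightarrow> x" "b \<longlonglongrightarrow> a" using yb by (auto intro: LIMSEQ_if_dist_inverse_Suc)
  obtain a0 s where "strict_mono (s :: nat \<Rightarrow> nat)" "(b \<circ> s) \<longlonglongrightarrow> a0" "c (x, a0) \<le> ereal M"
    by (rule K_inf_compact_sequence[OF c yb(1) lim(1) assms(2) yb(2) yb(5)])
  moreover from this have "a0 = a"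
    using LIMSEQ_subseq_LIMSEQ[OF lim(2)] LIMSEQ_unique by blast
  ultimately show False using assms(4) by simp
qed

text \<open>If costs stayed at most \<open>M\<close> at states tending to \<open>x\<close> and
  arbitrarily late actions, \<open>K_inf_compact_sequence\<close> would extract a subsequence of
  \<open>a\<close> converging in \<open>A\<close>.\<close>

lemma K_inf_compact_escape:
  fixes X :: "'a::metric_space set" and A :: "'b::metric_space set"
  assumes c: "K_inf_compact (top_of_set X) (top_of_set A) c"
    and a: "\<And>n. a n \<in> A"
    and nc: "\<And>l s. l \<in> A \<Longrightarrow> strict_mono (s :: nat \<Rightarrow> nat) \<Longrightarrow> \<not> (a \<circ> s) \<longlonglongrightarrow> l"
    and "x \<in> X"
  obtains e N where "e > 0"
    "\<And>y n. y \<in> X \<Longrightarrow> dist x y < e \<Longrightarrow> n \<ge> N \<Longrightarrow> ereal M < c (y, a n)"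
proof (rule ccontr)
  assume "\<not> thesis"
  then have ex: "\<exists>y n. y \<in> X \<and> dist x y < inverse (real (Suc k)) \<and> n \<ge> m \<and> c (y, a n) \<le> ereal M"
    for k m
    using that[of "inverse (real (Suc k))" m] by (force simp: not_less)
  \<comment> \<open>Pairs of a state and an index are chosen recursively; strictly increasing
    indices ensure that the selected actions form a subsequence of \<open>a\<close>.\<close>
  have "\<exists>p. \<forall>k. (fst (p k) \<in> X \<and> dist x (fst (p k)) < inverse (real (Suc k)) \<and>
      c (fst (p k), a (snd (p k))) \<le> ereal M) \<and> snd (p k) < snd (p (Suc k))"
  proof (rule dependent_nat_choice)
    show "\<exists>p. fst p \<in> X \<and> dist x (fst p) < inverse (real (Suc 0)) \<and> c (fst p, a (snd p)) \<le> ereal M"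
      using ex[of 0 0] by auto
    show "\<exists>q. (fst q \<in> X \<and> dist x (fst q) < inverse (real (Suc (Suc k))) \<and>
        c (fst q, a (snd q)) \<le> ereal M) \<and> snd p < snd q" for p :: "'a \<times> nat" and k
      using ex[of "Suc k" "Suc (snd p)"] by (auto simp: Suc_le_eq)
  qed
  then obtain p where p: "\<And>k. fst (p k) \<in> X" "\<And>k. dist x (fst (p k)) < inverse (real (Suc k))"
      "\<And>k. c (fst (p k), a (snd (p k))) \<le> ereal M" "strict_mono (\<lambda>k. snd (p k))"
    by (metis strict_mono_Suc_iff)
  have lim: "(\<lambda>k. fst (p k)) \<longlonglongrightarrow> x" using p by (auto intro: LIMSEQ_if_dist_inverse_Suc)
  obtain a0 s where s: "a0 \<in> A" "strict_mono (s :: nat \<Rightarrow> nat)" "((\<lambda>k. a (snd (p k))) \<circ> s) \<longlonglongrightarrow> a0"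
    by (rule K_inf_compact_sequence[OF c p(1) lim assms(4) a p(3)])
  have "strict_mono ((\<lambda>k. snd (p k)) \<circ> s)" by (rule strict_mono_o[OF p(4) s(2)])
  then show False using nc[OF s(1)] s(3) by (simp add: o_def)
qed

section \<open>Integrals of the shifted cost \<open>c - L\<close>\<close>

text \<open>\<open>e2ennreal\<close> only changes negative values, which a strict comparison with
  \<open>M \<ge> 0\<close> cannot detect.\<close>

lemma ennreal_less_e2ennreal_diff_iff:
  "0 \<le> M \<Longrightarrow> ennreal M < e2ennreal (t - ereal L) \<longleftrightarrow> ereal (M + L) < t"
  by (cases t) (auto simp: ennreal_less_iff e2ennreal_neg less_top[symmetric])

lemma nn_integral_cost_lsc:
  fixes X :: "'a::metric_space set" and A :: "'b::metric_space set"
  assumes c: "K_inf_compact (top_of_set X) (top_of_set A) c"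
    and "X \<noteq> {}" and z: "z \<in> prob_measures_on X" and a: "a \<in> A"
    and u: "u < (\<integral>\<^sup>+x. e2ennreal (c (x, a) - ereal L) \<partial>z)"
  obtains W e where "openin (weak_topology X) W" "z \<in> W" "e > 0"
    "\<And>z' b. z' \<in> W \<Longrightarrow> b \<in> A \<Longrightarrow> dist a b < e \<Longrightarrow>
      u < (\<integral>\<^sup>+x. e2ennreal (c (x, b) - ereal L) \<partial>z')"
proof -
  \<comment> \<open>\<open>F N\<close> takes the worst action in a ball around \<open>a\<close>, so
    one \<open>N\<close> serves all nearby actions at once. With \<open>N\<close> for
    \<open>Suc N\<close> the ball at \<open>0\<close> would be empty, its infimum
    \<open>\<top>\<close>, and \<open>F\<close> not increasing.\<close>
  define B where "B N = {b \<in> A. dist a b < inverse (real (Suc N))}" for N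
  define F where "F N x = (INF b\<in>B N. e2ennreal (c (x, b) - ereal L))" for N x
  obtain N W where W: "openin (weak_topology X) W" "z \<in> W"
    and F: "\<And>z'. z' \<in> W \<Longrightarrow> u < (\<integral>\<^sup>+x. F N x \<partial>z')"
  proof (rule fatou_weak[OF assms(2) z _ _ u, of F])
    fix M N :: nat and x assume "M \<le> N"
    then have "inverse (real (Suc N)) \<le> inverse (real (Suc M))" by simp
    then have "B N \<subseteq> B M" by (auto simp: B_def simp del: of_nat_Suc intro: order_less_le_trans)
    then show "F M x \<le> F N x" unfolding F_def by (rule INF_superset_mono) simp
  next
    fix x M assume x: "x \<in> X" "0 \<le> M" "ennreal M < e2ennreal (c (x, a) - ereal L)"
    then have "ereal (M + L) < c (x, a)" by (simp add: ennreal_less_e2ennreal_diff_iff)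
    from K_inf_compact_lsc[OF c x(1) a this] obtain e where e: "e > 0"
      "\<And>y b. y \<in> X \<Longrightarrow> b \<in> A \<Longrightarrow> dist x y < e \<Longrightarrow> dist a b < e \<Longrightarrow> ereal (M + L) < c (y, b)"
      by blast
    obtain N where N: "inverse (real (Suc N)) < e" using reals_Archimedean[OF e(1)] by blast
    have "ennreal M \<le> F N y" if "y \<in> X" "dist x y < e" for y
      unfolding F_def
    proof (rule INF_greatest)
      fix b assume "b \<in> B N"
      then have "ereal (M + L) < c (y, b)" using N that by (intro e(2)) (auto simp: B_def)
      then show "ennreal M \<le> e2ennreal (c (y, b) - ereal L)"
        using ennreal_less_e2ennreal_diff_iff[OF x(2)] by (metis less_imp_le)
    qed
    with e(1) show "\<exists>e>0. \<exists>N. \<forall>y\<in>X. dist x y < e \<longrightarrow> ennreal M \<le> F N y" by blast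
  qed blast
  have "u < (\<integral>\<^sup>+x. e2ennreal (c (x, b) - ereal L) \<partial>z')"
    if "z' \<in> W" "b \<in> A" "dist a b < inverse (real (Suc N))" for z' b
    by (rule order_less_le_trans[OF F[OF that(1)] nn_integral_mono])
      (use that in \<open>auto simp: F_def B_def intro: INF_lower\<close>)
  with W show ?thesis using that[of W "inverse (real (Suc N))"] by simp
qed

lemma nn_integral_cost_convergent_subseq:
  fixes X :: "'a::metric_space set" and A :: "'b::metric_space set"
  assumes c: "K_inf_compact (top_of_set X) (top_of_set A) c"
    and "X \<noteq> {}" and K: "compactin (weak_topology X) K"
    and z: "\<And>n::nat. z n \<in> K" and a: "\<And>n. a n \<in> A"
    and u: "\<And>n. (\<integral>\<^sup>+x. e2ennreal (c (x, a n) - ereal L) \<partial>z n) \<le> u" "u < \<top>"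
  obtains l s where "l \<in> A" "strict_mono (s :: nat \<Rightarrow> nat)" "(a \<circ> s) \<longlonglongrightarrow> l"
proof (rule ccontr)
  assume "\<not> thesis"
  then have nc: "\<And>l s. l \<in> A \<Longrightarrow> strict_mono (s :: nat \<Rightarrow> nat) \<Longrightarrow> \<not> (a \<circ> s) \<longlonglongrightarrow> l"
    using that by blast
  obtain z0 where z0: "z0 \<in> K" "\<And>U N. openin (weak_topology X) U \<Longrightarrow> z0 \<in> U \<Longrightarrow> \<exists>n\<ge>N. z n \<in> U"
    by (rule compactin_sequence_cluster_point[where z=z, OF K z]) blast
  have z0P: "z0 \<in> prob_measures_on X" using compactin_subset_topspace[OF K] z0(1) by auto
  then interpret prob_space z0 by (rule prob_measures_onD)
  \<comment> \<open>\<open>z0\<close> has mass one, so the constant \<open>\<top>\<close> integrates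
    to \<open>\<top>\<close>; it is the \<open>g\<close> of \<open>fatou_weak\<close>, reflecting
    that costs blow up at every state.\<close>
  have top: "u < (\<integral>\<^sup>+x. \<top> \<partial>z0)" using u(2) by (simp add: emeasure_space_1)
  define F where "F N x = (INF n\<in>{N..}. e2ennreal (c (x, a n) - ereal L))" for N x
  obtain N W where W: "openin (weak_topology X) W" "z0 \<in> W"
    and F: "\<And>z'. z' \<in> W \<Longrightarrow> u < (\<integral>\<^sup>+x. F N x \<partial>z')"
  proof (rule fatou_weak[OF assms(2) z0P _ _ top, of F])
    fix M N :: nat and x assume "M \<le> N"
    then show "F M x \<le> F N x" unfolding F_def by (intro INF_superset_mono) auto
  next
    fix x and M :: real assume x: "x \<in> X" "0 \<le> M"
    from K_inf_compact_escape[OF c a nc x(1), of "M + L"] obtain e N where e: "e > 0"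
      "\<And>y n. y \<in> X \<Longrightarrow> dist x y < e \<Longrightarrow> n \<ge> N \<Longrightarrow> ereal (M + L) < c (y, a n)"
      by blast
    have "ennreal M \<le> F N y" if "y \<in> X" "dist x y < e" for y
      unfolding F_def using e(2)[OF that] ennreal_less_e2ennreal_diff_iff[OF x(2)]
      by (intro INF_greatest) (metis atLeast_iff less_imp_le)
    with e(1) show "\<exists>e>0. \<exists>N. \<forall>y\<in>X. dist x y < e \<longrightarrow> ennreal M \<le> F N y" by blast
  qed blast
  \<comment> \<open>\<open>n \<ge> N\<close> puts \<open>a n\<close> under the infimum
    \<open>F N\<close>, and \<open>z n \<in> W\<close> makes the integral of \<open>F N\<close>
    exceed \<open>u\<close>.\<close>
  obtain n where n: "n \<ge> N" "z n \<in> W" using z0(2)[OF W] by blast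
  have "u < (\<integral>\<^sup>+x. e2ennreal (c (x, a n) - ereal L) \<partial>z n)"
    by (rule order_less_le_trans[OF F[OF n(2)] nn_integral_mono])
      (use n in \<open>auto simp: F_def intro: INF_lower\<close>)
  with u(1)[of n] show False by simp
qed

section \<open>Reducing the averaged cost to a nonnegative integral\<close>

text \<open>The section at \<open>a\<close> is lower semicontinuous, so its strict superlevel sets
  are open in \<open>X\<close>.\<close>

lemma K_inf_compact_borel_measurable:
  fixes X :: "'a::metric_space set" and A :: "'b::metric_space set"
  assumes c: "K_inf_compact (top_of_set X) (top_of_set A) c" and a: "a \<in> A"
    and L: "\<And>x. x \<in> X \<Longrightarrow> ereal L \<le> c (x, a)"
  shows "(\<lambda>x. c (x, a)) \<in> borel_measurable (restrict_space borel X)"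
proof (rule borel_measurableI_greater)
  fix r :: ereal
  have "openin (top_of_set X) {x \<in> X. r < c (x, a)}"
  proof (cases r)
    case (real M)
    have "\<exists>e>0. \<forall>y\<in>X. dist y x < e \<longrightarrow> y \<in> {x \<in> X. r < c (x, a)}" if xr: "x \<in> X" "r < c (x, a)" for x
    proof -
      obtain e where e: "e > 0"
        "\<And>y b. y \<in> X \<Longrightarrow> b \<in> A \<Longrightarrow> dist x y < e \<Longrightarrow> dist a b < e \<Longrightarrow> ereal M < c (y, b)"
        by (rule K_inf_compact_lsc[OF c xr(1) a xr(2)[unfolded real]], rule that)
      have "y \<in> {x \<in> X. r < c (x, a)}" if "y \<in> X" "dist y x < e" for y
        using e(2)[OF that(1) a] that e(1) unfolding real by (simp add: dist_commute)
      with e(1) show ?thesis by blast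
    qed
    then show ?thesis unfolding openin_euclidean_subtopology_iff by blast
  next
    \<comment> \<open>The lower bound \<open>L\<close> excludes the value
      \<open>-\<infinity>\<close>, so the set is all of \<open>X\<close>.\<close>
    case MInf
    have "r < c (x, a)" if "x \<in> X" for x
      unfolding MInf by (rule order_less_le_trans[OF _ L[OF that]]) simp
    then have "{x \<in> X. r < c (x, a)} = X" by blast
    then show ?thesis by simp
  qed simp
  then obtain T where "open T" "{x \<in> X. r < c (x, a)} = X \<inter> T"
    unfolding openin_open by blast
  moreover from this(1) have "X \<inter> T \<in> sets (restrict_space borel X)"
    unfolding sets_restrict_space by (intro imageI) simp
  ultimately show "{x \<in> space (restrict_space borel X). r < c (x, a)} \<in> sets (restrict_space borel X)"
    by (simp only: space_restrict_space space_borel Int_UNIV_right)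
qed

lemma averaged_cost_eq:
  assumes z: "z \<in> prob_measures_on X"
    and m: "(\<lambda>x. c (x, a)) \<in> borel_measurable (restrict_space borel X)"
    and L: "\<And>x. x \<in> X \<Longrightarrow> ereal L \<le> c (x, a)"
  shows "averaged_cost c (z, a) =
    enn2ereal (\<integral>\<^sup>+x. e2ennreal (c (x, a) - ereal L) \<partial>z) + ereal L"
proof -
  interpret prob_space z by (rule prob_measures_onD[OF z])
  have mz [measurable]: "(\<lambda>x. c (x, a)) \<in> borel_measurable z"
    using m by (simp add: measurable_cong_sets[OF prob_measures_onD(1)[OF z] refl])
  let ?I = "\<integral>\<^sup>+x. e2ennreal (c (x, a) - ereal L) \<partial>z"
  let ?P = "\<integral>\<^sup>+x. e2ennreal (c (x, a)) \<partial>z"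
  let ?Q = "\<integral>\<^sup>+x. e2ennreal (- c (x, a)) \<partial>z"
  \<comment> \<open>The negative part is at most that of \<open>L\<close>, so \<open>?Q\<close> is
    finite and can be cancelled.\<close>
  have le: "e2ennreal (- c (x, a)) \<le> ennreal (- L)" if "x \<in> space z" for x
  proof -
    have "- c (x, a) \<le> ereal (- L)" using L[of x] that prob_measures_onD(2)[OF z]
      by (simp add: ereal_uminus_le_reorder)
    then show ?thesis by (metis e2ennreal_ereal e2ennreal_mono)
  qed
  have "?Q \<le> (\<integral>\<^sup>+x. ennreal (- L) \<partial>z)" by (rule nn_integral_mono) (rule le)
  also have "\<dots> = ennreal (- L)" by (simp add: emeasure_space_1)
  finally have Q: "?Q \<le> ennreal (- L)" .
  \<comment> \<open>\<open>(c - L) + L\<^sup>+ + c\<^sup>- = c\<^sup>+ + L\<^sup>-\<close>, arranged so that no subtraction occurs in \<open>ennreal\<close>\<close>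
  have pt: "e2ennreal (c (x, a) - ereal L) + ennreal L + e2ennreal (- c (x, a)) =
      e2ennreal (c (x, a)) + ennreal (- L)" if "x \<in> space z" for x
    using L[of x] that prob_measures_onD(2)[OF z]
    by (cases "c (x, a)"; cases "0 \<le> L"; cases "0 \<le> real_of_ereal (c (x, a))")
      (auto simp: e2ennreal_neg ennreal_neg simp flip: ennreal_plus)
  have "?I + ennreal L + ?Q = (\<integral>\<^sup>+x. e2ennreal (c (x, a) - ereal L) + ennreal L + e2ennreal (- c (x, a)) \<partial>z)"
    by (simp add: nn_integral_add emeasure_space_1)
  also have "\<dots> = (\<integral>\<^sup>+x. e2ennreal (c (x, a)) + ennreal (- L) \<partial>z)"
    by (rule nn_integral_cong) (rule pt)
  also have "\<dots> = ?P + ennreal (- L)"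
    by (simp add: nn_integral_add emeasure_space_1)
  finally have eq: "?I + ennreal L + ?Q = ?P + ennreal (- L)" .
  \<comment> \<open>By the sign of \<open>L\<close>, either \<open>ennreal (- L)\<close> or
    \<open>ennreal L\<close> vanishes; in the first case \<open>?Q\<close> does too.\<close>
  have "enn2ereal ?P - enn2ereal ?Q = enn2ereal ?I + ereal L"
  proof (cases "0 \<le> L")
    case True
    then have "?Q = 0" using Q by (simp add: ennreal_neg)
    then show ?thesis
      using eq True by (cases ?I; cases ?P) (auto simp: ennreal_neg zero_ennreal.rep_eq simp flip: ennreal_plus)
  next
    case False
    then show ?thesis
      using eq Q by (cases ?I; cases ?P; cases ?Q) (auto simp: ennreal_neg top_unique simp flip: ennreal_plus)
  qed
  then show ?thesis by (simp add: averaged_cost_def ereal_integral_def)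
qed

text \<open>For \<open>r < L\<close> the difference would be truncated to \<open>0\<close>, and
  \<open>I = 0\<close> would satisfy the right side but not the left.\<close>

lemma averaged_cost_le_iff:
  assumes "averaged_cost c (z, a) = enn2ereal I + ereal L" and "L \<le> r"
  shows "averaged_cost c (z, a) \<le> ereal r \<longleftrightarrow> I \<le> ennreal (r - L)"
  using assms by (cases I) (auto simp: top_unique)

section \<open>Compactness of the sublevel sets of the averaged cost\<close>

theorem theorem3p4:
  fixes X :: "'a::polish_space set" and A :: "'b::polish_space set"
    and c :: "'a \<times> 'b \<Rightarrow> ereal" and L :: real
  assumes "X \<in> sets borel" and "X \<noteq> {}"
    and "A \<in> sets borel" and "A \<noteq> {}"
    and "\<forall>x\<in>X. \<forall>a\<in>A. c (x, a) \<noteq> -\<infinity>"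
    and "\<forall>x\<in>X. \<forall>a\<in>A. ereal L \<le> c (x, a)"
    and "K_inf_compact (top_of_set X) (top_of_set A) c"
  shows "(\<forall>z\<in>prob_measures_on X. \<forall>a\<in>A. ereal L \<le> averaged_cost c (z, a)) \<and>
         K_inf_compact (weak_topology X) (top_of_set A) (averaged_cost c)"
proof -
  let ?I = "\<lambda>z a. \<integral>\<^sup>+x. e2ennreal (c (x, a) - ereal L) \<partial>z"
  have eq: "averaged_cost c (z, a) = enn2ereal (?I z a) + ereal L"
    if "z \<in> prob_measures_on X" "a \<in> A" for z a
    by (rule averaged_cost_eq[where X=X and L=L and c=c and a=a and z=z])
      (use that assms in \<open>auto intro!: K_inf_compact_borel_measurable\<close>)
  have ge: "ereal L \<le> averaged_cost c (z, a)" if "z \<in> prob_measures_on X" "a \<in> A" for z a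
    by (simp add: eq[OF that] ereal_le_add_self2)
  have "compactin (prod_topology (subtopology (weak_topology X) K) (top_of_set A))
      {s \<in> topspace (prod_topology (subtopology (weak_topology X) K) (top_of_set A)).
        averaged_cost c s \<le> ereal r}"
    if K: "compactin (weak_topology X) K" for K and r :: real
  proof -
    have KP: "K \<subseteq> prob_measures_on X" using compactin_subset_topspace[OF K] by simp
    define T where "T = {s \<in> K \<times> A. averaged_cost c s \<le> ereal r}"
    have T_eq: "{s \<in> topspace (prod_topology (subtopology (weak_topology X) K) (top_of_set A)).
        averaged_cost c s \<le> ereal r} = T"
      using KP by (auto simp: T_def)
    \<comment> \<open>Compactness can then be tested in the full product with the weak
      topology.\<close>
    have prod_eq: "prod_topology (subtopology (weak_topology X) K) (top_of_set A) =
        subtopology (prod_topology (weak_topology X) (top_of_set A)) (K \<times> A)"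
      using prod_topology_subtopology(1)[of "weak_topology X" K "top_of_set A"] by simp
    have "compactin (prod_topology (weak_topology X) (top_of_set A)) T"
    proof (cases "L \<le> r")
      case False
      have "averaged_cost c (z, a) > ereal r" if "z \<in> K" "a \<in> A" for z a
      proof -
        have "ereal r < ereal L" using False by simp
        also have "\<dots> \<le> averaged_cost c (z, a)" using ge[OF subsetD[OF KP that(1)] that(2)] .
        finally show ?thesis .
      qed
      then have "T = {}" by (force simp: T_def)
      then show ?thesis by simp
    next
      case True
      let ?u = "ennreal (r - L)"
      have le_iff: "averaged_cost c (z, a) \<le> ereal r \<longleftrightarrow> ?I z a \<le> ?u"
        if "z \<in> prob_measures_on X" "a \<in> A" for z a
        by (rule averaged_cost_le_iff[OF eq[OF that] True])
      have less_iff: "ereal r < averaged_cost c (z, a) \<longleftrightarrow> ?u < ?I z a"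
        if "z \<in> prob_measures_on X" "a \<in> A" for z a
        using le_iff[OF that] by (simp only: not_le[symmetric])
      \<comment> \<open>Lower semicontinuity of the averaged cost, used to make its sublevel set
        closed in the whole product.\<close>
      have "openin (prod_topology (weak_topology X) (top_of_set A))
          {s \<in> prob_measures_on X \<times> A. ereal r < averaged_cost c s}"
        unfolding openin_prod_topology_alt
      proof (intro allI impI)
        fix z a assume "(z, a) \<in> {s \<in> prob_measures_on X \<times> A. ereal r < averaged_cost c s}"
        then have za: "z \<in> prob_measures_on X" "a \<in> A" "?u < ?I z a"
          using less_iff[of z a] by simp_all
        obtain W e where W: "openin (weak_topology X) W" "z \<in> W" "e > 0"
          "\<And>z' b. z' \<in> W \<Longrightarrow> b \<in> A \<Longrightarrow> dist a b < e \<Longrightarrow> ?u < ?I z' b"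
          by (rule nn_integral_cost_lsc[OF assms(7,2) za], rule that)
        have "W \<subseteq> prob_measures_on X" using openin_subset[OF W(1)] by simp
        have "W \<times> (A \<inter> ball a e) \<subseteq> {s \<in> prob_measures_on X \<times> A. ereal r < averaged_cost c s}"
        proof clarify
          fix z' b assume "z' \<in> W" "b \<in> A" "b \<in> ball a e"
          moreover from this have "z' \<in> prob_measures_on X"
            using \<open>W \<subseteq> prob_measures_on X\<close> by blast
          ultimately show "(z', b) \<in> prob_measures_on X \<times> A \<and> ereal r < averaged_cost c (z', b)"
            using less_iff[of z' b] W(4)[of z' b] by simp
        qed
        moreover have "openin (top_of_set A) (A \<inter> ball a e)" by (simp add: openin_open_Int)
        ultimately show "\<exists>U V. openin (weak_topology X) U \<and> openin (top_of_set A) V \<and> z \<in> U \<and>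
            a \<in> V \<and> U \<times> V \<subseteq> {s \<in> prob_measures_on X \<times> A. ereal r < averaged_cost c s}"
          using W(1-3) za(2) by (intro exI[of _ W] exI[of _ "A \<inter> ball a e"]) simp
      qed
      moreover have "{s \<in> prob_measures_on X \<times> A. averaged_cost c s \<le> ereal r} =
          topspace (prod_topology (weak_topology X) (top_of_set A)) -
          {s \<in> prob_measures_on X \<times> A. ereal r < averaged_cost c s}"
        by (auto simp: not_le)
      ultimately have closed: "closedin (prod_topology (weak_topology X) (top_of_set A))
          {s \<in> prob_measures_on X \<times> A. averaged_cost c s \<le> ereal r}"
        by (simp only: closedin_diff[OF closedin_topspace])
      \<comment> \<open>Only the actions live in a metric space, so sequences are used for the
        projection of \<open>T\<close> alone. A limit action \<open>l\<close> is paired with a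
        cluster point \<open>z0\<close> of the measures along the same subsequence.\<close>
      have "compact (snd ` T)"
        unfolding compact_def
      proof (intro allI impI)
        fix a :: "nat \<Rightarrow> 'b" assume "\<forall>n. a n \<in> snd ` T"
        then have "\<forall>n. \<exists>z. (z, a n) \<in> T" by force
        then obtain z where z: "\<And>n. (z n, a n) \<in> T" by metis
        then have zK: "\<And>n. z n \<in> K" and aA: "\<And>n. a n \<in> A" by (auto simp: T_def)
        have Iu: "?I (z n) (a n) \<le> ?u" for n
          using z[of n] le_iff[OF subsetD[OF KP zK] aA, of n n] by (simp add: T_def)
        obtain l s where l: "l \<in> A" "strict_mono (s :: nat \<Rightarrow> nat)" "(a \<circ> s) \<longlonglongrightarrow> l"
          by (rule nn_integral_cost_convergent_subseq[OF assms(7,2) K zK aA Iu ennreal_less_top], rule that)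
        obtain z0 where z0: "z0 \<in> K"
          "\<And>U N. openin (weak_topology X) U \<Longrightarrow> z0 \<in> U \<Longrightarrow> \<exists>n\<ge>N. z (s n) \<in> U"
          by (rule compactin_sequence_cluster_point[OF K, of "\<lambda>n. z (s n)", OF zK], rule that)
        have z0P: "z0 \<in> prob_measures_on X" using z0(1) KP by blast
        \<comment> \<open>Otherwise semicontinuity keeps the integral above \<open>?u\<close> near
          \<open>(z0, l)\<close>, a neighbourhood that some \<open>(z (s n), a (s n))\<close>
          enters.\<close>
        have "?I z0 l \<le> ?u"
        proof (rule ccontr)
          assume "\<not> ?I z0 l \<le> ?u"
          then have less: "?u < ?I z0 l" by simp
          obtain W e where W: "openin (weak_topology X) W" "z0 \<in> W" "e > 0"
            "\<And>z' b. z' \<in> W \<Longrightarrow> b \<in> A \<Longrightarrow> dist l b < e \<Longrightarrow> ?u < ?I z' b"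
            by (rule nn_integral_cost_lsc[OF assms(7,2) z0P l(1) less], rule that)
          obtain N where N: "\<And>n. n \<ge> N \<Longrightarrow> dist l (a (s n)) < e"
            using metric_LIMSEQ_D[OF l(3) W(3)] unfolding o_def dist_commute[of l] by blast
          obtain n where "n \<ge> N" "z (s n) \<in> W" using z0(2)[OF W(1,2)] by blast
          then have "?u < ?I (z (s n)) (a (s n))" by (intro W(4) aA N)
          with Iu[of "s n"] show False by simp
        qed
        then have "(z0, l) \<in> T" using z0(1) l(1) le_iff[OF z0P l(1)] by (simp add: T_def)
        then have "l \<in> snd ` T" by (rule image_eqI[rotated]) simp
        with l(2,3) show "\<exists>l\<in>snd ` T. \<exists>s. strict_mono s \<and> (a \<circ> s) \<longlonglongrightarrow> l"
          by blast
      qed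
      moreover have "snd ` T \<subseteq> A" by (auto simp: T_def)
      ultimately have "compactin (top_of_set A) (snd ` T)" by (simp add: compactin_subtopology)
      \<comment> \<open>\<open>T\<close> is the closed sublevel set cut by this compact rectangle,
        hence compact.\<close>
      with K have "compactin (prod_topology (weak_topology X) (top_of_set A)) (K \<times> snd ` T)"
        by (simp add: compactin_Times)
      from closed_Int_compactin[OF closed this]
      have "compactin (prod_topology (weak_topology X) (top_of_set A))
          ({s \<in> prob_measures_on X \<times> A. averaged_cost c s \<le> ereal r} \<inter> K \<times> snd ` T)" .
      moreover have "{s \<in> prob_measures_on X \<times> A. averaged_cost c s \<le> ereal r} \<inter> K \<times> snd ` T = T"
      proof
        show "T \<subseteq> {s \<in> prob_measures_on X \<times> A. averaged_cost c s \<le> ereal r} \<inter> K \<times> snd ` T"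
        proof
          fix s assume "s \<in> T"
          then have "snd s \<in> snd ` T" "fst s \<in> K" "snd s \<in> A" "averaged_cost c s \<le> ereal r"
            by (rule imageI) (use \<open>s \<in> T\<close> in \<open>auto simp: T_def\<close>)
          then show "s \<in> {s \<in> prob_measures_on X \<times> A. averaged_cost c s \<le> ereal r} \<inter> K \<times> snd ` T"
            using KP by (simp add: mem_Times_iff subset_iff)
        qed
      qed (auto simp: T_def)
      ultimately show ?thesis by (simp only:)
    qed
    then show ?thesis
      by (subst T_eq, subst prod_eq) (auto simp: compactin_subtopology T_def)
  qed
  then show ?thesis using ge by (simp add: K_inf_compact_def inf_compact_def)
qed

end
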